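(* The system $\lambda_{\mathrm{alg}}+\mathrm{itco}$ is Turing-complete: for every partial recursive function $f:\mathbb{N}^n\rightharpoonup\mathbb{N}$ there is a term of the system of type $\mathbb{N}^n\to\mathbb{N}$ whose evaluation on an input $\vec x$ terminates with result $y$ exactly when $f(\vec x)$ is defined and equal to $y$, and does not terminate when $f(\vec x)$ is undefined.
   Context: $\lambda_{\mathrm{alg}}$ is a typed $\lambda$-calculus containing algebraic data types (in particular the natural numbers $\mathbb{N}$, products and binary sums $A+B$ with injections $\mathsf{inl},\mathsf{inr}$) with definition by cases, and function types with $\lambda$-abstraction and application. The rule $\mathrm{itco}$ adds, for every term $g:A\to A+B$, a term $\mathsf{itcompute}\,g:A\to B$ with the following computation behaviour: for $a:A$, if $g\,a=\mathsf{inr}\,b$ then $(\mathsf{itcompute}\,g)\,a$ evaluates to $b$; if $g\,a=\mathsf{inl}\,a'$ then $(\mathsf{itcompute}\,g)\,a$ reduces to $(\mathsf{itcompute}\,g)\,a'$ and the evaluation continues; if this process never reaches an $\mathsf{inr}$ case, the computation does not terminate. Partial recursive functions are those generated from zero, successor and projections by composition, primitive recursion and minimization. *)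

theory Defs
  imports Main
begin

section \<open>Types of \<open>\<lambda>\<^sub>a\<^sub>l\<^sub>g\<close>\<close>

text \<open>
  An algebraic data type is given by the list of its constructors, each constructor being given
  by the list of its arguments.  An argument \<open>None\<close> is a recursive occurrence of the data type being
  declared, an argument \<open>Some A\<close> has the type \<open>A\<close>.  The declared type itself can therefore never
  occur inside a function type of its own declaration.
\<close>

datatype ty =
    TFun ty ty  (infixr "\<rightarrow>" 65)
  | TData "ty option list list"

type_synonym decl = "ty option list list"

abbreviation nat_decl :: decl where "nat_decl \<equiv> [[], [None]]"
abbreviation unit_decl :: decl where "unit_decl \<equiv> [[]]"
abbreviation prod_decl :: "ty \<Rightarrow> ty \<Rightarrow> decl" where "prod_decl A B \<equiv> [[Some A, Some B]]"
abbreviation sum_decl :: "ty \<Rightarrow> ty \<Rightarrow> decl" where "sum_decl A B \<equiv> [[Some A], [Some B]]"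

abbreviation TNat :: ty where "TNat \<equiv> TData nat_decl"
abbreviation TUnit :: ty where "TUnit \<equiv> TData unit_decl"
abbreviation TProd :: "ty \<Rightarrow> ty \<Rightarrow> ty"  (infixr "\<otimes>" 75) where "A \<otimes> B \<equiv> TData (prod_decl A B)"
abbreviation TSum :: "ty \<Rightarrow> ty \<Rightarrow> ty"  (infixr "\<oplus>" 70) where "A \<oplus> B \<equiv> TData (sum_decl A B)"

fun arg_ty :: "decl \<Rightarrow> ty option \<Rightarrow> ty" where
  "arg_ty D None = TData D"
| "arg_ty D (Some A) = A"

section \<open>Terms of \<open>\<lambda>\<^sub>a\<^sub>l\<^sub>g + itco\<close>\<close>

text \<open>
  Variables are de Bruijn indices.  \<open>Con D i ts\<close> is the \<open>i\<close>-th constructor of the data type declared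
  by \<open>D\<close>, applied to all its arguments.  The branches of \<open>Case t bs\<close> are not binders: the branch for
  a constructor with \<open>k\<close> arguments is a curried function of these \<open>k\<close> arguments.
  \<open>Itco A B g\<close> is \<open>itcompute g\<close> for \<open>g : A \<rightarrow> A \<oplus> B\<close>.
\<close>

datatype tm =
    Var nat
  | Lam ty tm
  | App tm tm
  | Con decl nat "tm list"
  | Case tm "tm list"
  | Itco ty ty tm

abbreviation zero_tm :: tm where "zero_tm \<equiv> Con nat_decl 0 []"
abbreviation succ_tm :: "tm \<Rightarrow> tm" where "succ_tm t \<equiv> Con nat_decl 1 [t]"
abbreviation pair_tm :: "ty \<Rightarrow> ty \<Rightarrow> tm \<Rightarrow> tm \<Rightarrow> tm" where "pair_tm A B s t \<equiv> Con (prod_decl A B) 0 [s, t]"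
abbreviation inl_tm :: "ty \<Rightarrow> ty \<Rightarrow> tm \<Rightarrow> tm" where "inl_tm A B t \<equiv> Con (sum_decl A B) 0 [t]"
abbreviation inr_tm :: "ty \<Rightarrow> ty \<Rightarrow> tm \<Rightarrow> tm" where "inr_tm A B t \<equiv> Con (sum_decl A B) 1 [t]"

inductive has_type :: "ty list \<Rightarrow> tm \<Rightarrow> ty \<Rightarrow> bool"  ("_ \<turnstile> _ : _" [51, 51, 51] 50) where
  T_Var: "i < length \<Gamma> \<Longrightarrow> \<Gamma> \<turnstile> Var i : \<Gamma> ! i"
| T_Lam: "A # \<Gamma> \<turnstile> t : B \<Longrightarrow> \<Gamma> \<turnstile> Lam A t : A \<rightarrow> B"
| T_App: "\<Gamma> \<turnstile> s : A \<rightarrow> B \<Longrightarrow> \<Gamma> \<turnstile> t : A \<Longrightarrow> \<Gamma> \<turnstile> App s t : B"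
| T_Con: "i < length D \<Longrightarrow> list_all2 (\<lambda>t a. \<Gamma> \<turnstile> t : arg_ty D a) ts (D ! i)
    \<Longrightarrow> \<Gamma> \<turnstile> Con D i ts : TData D"
| T_Case: "\<Gamma> \<turnstile> t : TData D
    \<Longrightarrow> list_all2 (\<lambda>b as. \<Gamma> \<turnstile> b : foldr (\<lambda>a B. arg_ty D a \<rightarrow> B) as C) bs D
    \<Longrightarrow> \<Gamma> \<turnstile> Case t bs : C"
| T_Itco: "\<Gamma> \<turnstile> g : A \<rightarrow> A \<oplus> B \<Longrightarrow> \<Gamma> \<turnstile> Itco A B g : A \<rightarrow> B"

section \<open>Evaluation\<close>

fun lift :: "nat \<Rightarrow> tm \<Rightarrow> tm" where
  "lift k (Var i) = (if i < k then Var i else Var (Suc i))"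
| "lift k (Lam A t) = Lam A (lift (Suc k) t)"
| "lift k (App s t) = App (lift k s) (lift k t)"
| "lift k (Con D i ts) = Con D i (map (lift k) ts)"
| "lift k (Case t bs) = Case (lift k t) (map (lift k) bs)"
| "lift k (Itco A B g) = Itco A B (lift k g)"

fun subst :: "nat \<Rightarrow> tm \<Rightarrow> tm \<Rightarrow> tm" where
  "subst k u (Var i) = (if i < k then Var i else if i = k then u else Var (i - 1))"
| "subst k u (Lam A t) = Lam A (subst (Suc k) (lift 0 u) t)"
| "subst k u (App s t) = App (subst k u s) (subst k u t)"
| "subst k u (Con D i ts) = Con D i (map (subst k u) ts)"
| "subst k u (Case t bs) = Case (subst k u t) (map (subst k u) bs)"
| "subst k u (Itco A B g) = Itco A B (subst k u g)"

inductive is_value :: "tm \<Rightarrow> bool" where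
  V_Lam: "is_value (Lam A t)"
| V_Con: "(\<forall>v\<in>set vs. is_value v) \<Longrightarrow> is_value (Con D i vs)"
| V_Itco: "is_value g \<Longrightarrow> is_value (Itco A B g)"

text \<open>
  Left-to-right call-by-value.  Rule \<open>S_Itco\<close> puts the evaluation of \<open>g v\<close> into the scrutinee of a
  case distinction, so that it is part of the same reduction sequence; \<open>itco_inl\<close> and \<open>itco_inr\<close>
  below are the resulting computation rules of \<open>itcompute g\<close>.
\<close>

inductive step :: "tm \<Rightarrow> tm \<Rightarrow> bool"  (infix "\<leadsto>" 50) where
  S_Beta: "is_value v \<Longrightarrow> App (Lam A t) v \<leadsto> subst 0 v t"
| S_Case: "\<forall>v\<in>set vs. is_value v \<Longrightarrow> i < length bs
    \<Longrightarrow> Case (Con D i vs) bs \<leadsto> foldl App (bs ! i) vs"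
| S_Itco: "is_value g \<Longrightarrow> is_value v
    \<Longrightarrow> App (Itco A B g) v \<leadsto> Case (App g v) [Itco A B g, Lam B (Var 0)]"
| S_AppL: "s \<leadsto> s' \<Longrightarrow> App s t \<leadsto> App s' t"
| S_AppR: "is_value s \<Longrightarrow> t \<leadsto> t' \<Longrightarrow> App s t \<leadsto> App s t'"
| S_ConArg: "\<forall>v\<in>set vs. is_value v \<Longrightarrow> t \<leadsto> t'
    \<Longrightarrow> Con D i (vs @ t # ts) \<leadsto> Con D i (vs @ t' # ts)"
| S_CaseArg: "t \<leadsto> t' \<Longrightarrow> Case t bs \<leadsto> Case t' bs"
| S_ItcoArg: "g \<leadsto> g' \<Longrightarrow> Itco A B g \<leadsto> Itco A B g'"

abbreviation steps :: "tm \<Rightarrow> tm \<Rightarrow> bool"  (infix "\<leadsto>*" 50) where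
  "steps \<equiv> step\<^sup>*\<^sup>*"

definition evaluates_to :: "tm \<Rightarrow> tm \<Rightarrow> bool" where
  "evaluates_to t r \<longleftrightarrow> t \<leadsto>* r \<and> \<not> (\<exists>r'. r \<leadsto> r')"

definition terminates :: "tm \<Rightarrow> bool" where
  "terminates t \<longleftrightarrow> (\<exists>r. evaluates_to t r)"

lemma steps_CaseArg: "t \<leadsto>* t' \<Longrightarrow> Case t bs \<leadsto>* Case t' bs"
  by (induction rule: rtranclp_induct) (auto intro: S_CaseArg rtranclp.rtrancl_into_rtrancl)

lemma itco_inl:
  assumes "is_value g" "is_value a" "App g a \<leadsto>* inl_tm A B a'" "is_value a'"
  shows "App (Itco A B g) a \<leadsto>* App (Itco A B g) a'"
proof -
  have "App (Itco A B g) a \<leadsto> Case (App g a) [Itco A B g, Lam B (Var 0)]"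
    using assms by (intro S_Itco)
  moreover have "\<dots> \<leadsto>* Case (inl_tm A B a') [Itco A B g, Lam B (Var 0)]"
    using assms by (intro steps_CaseArg)
  moreover have "Case (inl_tm A B a') [Itco A B g, Lam B (Var 0)] \<leadsto> App (Itco A B g) a'"
    using S_Case[of "[a']" 0 "[Itco A B g, Lam B (Var 0)]"] assms by simp
  ultimately show ?thesis
    by (meson converse_rtranclp_into_rtranclp rtranclp.rtrancl_into_rtrancl)
qed

lemma itco_inr:
  assumes "is_value g" "is_value a" "App g a \<leadsto>* inr_tm A B b" "is_value b"
  shows "App (Itco A B g) a \<leadsto>* b"
proof -
  have "App (Itco A B g) a \<leadsto> Case (App g a) [Itco A B g, Lam B (Var 0)]"
    using assms by (intro S_Itco)
  moreover have "\<dots> \<leadsto>* Case (inr_tm A B b) [Itco A B g, Lam B (Var 0)]"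
    using assms by (intro steps_CaseArg)
  moreover have "Case (inr_tm A B b) [Itco A B g, Lam B (Var 0)] \<leadsto> App (Lam B (Var 0)) b"
    using S_Case[of "[b]" 1 "[Itco A B g, Lam B (Var 0)]"] assms by simp
  moreover have "App (Lam B (Var 0)) b \<leadsto> b"
    using S_Beta[of b B "Var 0"] assms by simp
  ultimately show ?thesis
    by (meson converse_rtranclp_into_rtranclp rtranclp.rtrancl_into_rtrancl)
qed

section \<open>Numerals and tuples\<close>

fun numeral_tm :: "nat \<Rightarrow> tm" where
  "numeral_tm 0 = zero_tm"
| "numeral_tm (Suc k) = succ_tm (numeral_tm k)"

fun nat_pow :: "nat \<Rightarrow> ty" where
  "nat_pow 0 = TUnit"
| "nat_pow (Suc 0) = TNat"
| "nat_pow (Suc (Suc n)) = TNat \<otimes> nat_pow (Suc n)"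

fun tuple_tm :: "nat list \<Rightarrow> tm" where
  "tuple_tm [] = Con unit_decl 0 []"
| "tuple_tm [x] = numeral_tm x"
| "tuple_tm (x # y # ys) =
    pair_tm TNat (nat_pow (length (y # ys))) (numeral_tm x) (tuple_tm (y # ys))"

section \<open>Partial recursive functions\<close>

text \<open>
  A partial function \<open>\<nat>\<^sup>n \<rightharpoonup> \<nat>\<close> is represented by a function on lists; only its values on lists of
  length \<open>n\<close> matter.
\<close>

type_synonym pfun = "nat list \<Rightarrow> nat option"

definition pcomp :: "pfun \<Rightarrow> pfun list \<Rightarrow> pfun" where
  "pcomp f gs xs =
    (if \<forall>g\<in>set gs. g xs \<noteq> None then f (map (\<lambda>g. the (g xs)) gs) else None)"

fun prec :: "pfun \<Rightarrow> pfun \<Rightarrow> nat \<Rightarrow> pfun" where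
  "prec f g 0 xs = f xs"
| "prec f g (Suc y) xs =
    (case prec f g y xs of None \<Rightarrow> None | Some r \<Rightarrow> g (y # r # xs))"

definition is_first_zero :: "pfun \<Rightarrow> nat list \<Rightarrow> nat \<Rightarrow> bool" where
  "is_first_zero f xs y \<longleftrightarrow>
    f (y # xs) = Some 0 \<and> (\<forall>z<y. \<exists>v. f (z # xs) = Some v \<and> v \<noteq> 0)"

definition pmin :: "pfun \<Rightarrow> pfun" where
  "pmin f xs =
    (if \<exists>y. is_first_zero f xs y then Some (THE y. is_first_zero f xs y) else None)"

inductive partial_recursive :: "nat \<Rightarrow> pfun \<Rightarrow> bool" where
  PR_zero: "partial_recursive n (\<lambda>xs. Some 0)"
| PR_succ: "partial_recursive 1 (\<lambda>xs. Some (Suc (xs ! 0)))"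
| PR_proj: "i < n \<Longrightarrow> partial_recursive n (\<lambda>xs. Some (xs ! i))"
| PR_comp: "partial_recursive (length gs) f \<Longrightarrow> (\<forall>g\<in>set gs. partial_recursive n g)
    \<Longrightarrow> partial_recursive n (pcomp f gs)"
| PR_prec: "partial_recursive n f \<Longrightarrow> partial_recursive (n + 2) g
    \<Longrightarrow> partial_recursive (n + 1) (\<lambda>xs. prec f g (hd xs) (tl xs))"
| PR_min: "partial_recursive (n + 1) f \<Longrightarrow> partial_recursive n (pmin f)"
| PR_ext: "partial_recursive n f \<Longrightarrow> (\<forall>xs. length xs = n \<longrightarrow> g xs = f xs)
    \<Longrightarrow> partial_recursive n g"

end

theory Submission
  imports Defs
begin

text \<open>
  Call-by-value reduction is deterministic, so a term diverges as soon as it starts an infinite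
  reduction sequence, and divergence propagates through evaluation contexts just as undefinedness
  propagates through strict composition.  All programs are composed from a few closed combinators
  (composition, pairing, case distinction on a number), which keeps de Bruijn indices out of the main
  argument.  Minimization iterates on states \<open>(y, xs)\<close>, leaving the loop at the first zero; primitive
  recursion iterates on states \<open>(k, i, r, xs)\<close> that count \<open>k\<close> down and \<open>i\<close> up while \<open>r\<close> holds the value
  at \<open>i\<close>.
\<close>

section \<open>Determinism and divergence\<close>

lemma value_no_step: "is_value v \<Longrightarrow> \<not> v \<leadsto> t"
proof (induction arbitrary: t rule: is_value.induct)
  case (V_Lam A u)
  show ?case by (auto elim: step.cases)
next
  case (V_Con vs D i)
  then show ?case by (auto elim!: step.cases[of "Con D i vs"])
next
  case (V_Itco g A B)
  then show ?case by (auto elim: step.cases[of "Itco A B g"])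
qed

lemma is_value_Con [simp]: "is_value (Con D i vs) \<longleftrightarrow> (\<forall>v\<in>set vs. is_value v)"
  by (auto intro: is_value.intros elim: is_value.cases)

lemma is_value_Lam [simp]: "is_value (Lam A t)"
  by (rule V_Lam)

lemma is_value_Itco [simp]: "is_value (Itco A B g) \<longleftrightarrow> is_value g"
  by (auto intro: is_value.intros elim: is_value.cases)

text \<open>An argument reduced by \<open>S_ConArg\<close> is not a value and has only values before
  it, so it is the leftmost non-value. This fixes the position of the redex among the constructor
  arguments.\<close>

lemma first_non_value_unique:
  assumes "vs @ t # ts = ws @ s # ss"
    and "\<forall>v\<in>set vs. is_value v" "\<forall>v\<in>set ws. is_value v"
    and "\<not> is_value t" "\<not> is_value s"
  shows "vs = ws \<and> t = s \<and> ts = ss"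
  using assms
proof (induction vs arbitrary: ws)
  case Nil
  then show ?case by (cases ws) auto
next
  case (Cons v vs)
  then show ?case by (cases ws) auto
qed

text \<open>Two different rules could apply to the same term only if some value took a step, which
  \<open>value_no_step\<close> excludes. Only \<open>S_ConArg\<close> needs an extra argument, since
  its redex position must be identified first.\<close>

lemma step_deterministic: "t \<leadsto> t1 \<Longrightarrow> t \<leadsto> t2 \<Longrightarrow> t1 = t2"
proof (induction arbitrary: t2 rule: step.induct)
  case (S_Beta v A t)
  from S_Beta(2) show ?case
    by cases (use S_Beta(1) value_no_step V_Lam in blast)+
next
  case (S_Case vs i bs D)
  from S_Case(3) show ?case
    by cases (use S_Case(1) value_no_step V_Con in blast)+
next
  case (S_Itco g v A B)
  from S_Itco(3) show ?case
    by cases (use S_Itco(1,2) value_no_step V_Itco in blast)+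
next
  case (S_AppL s s' t)
  from S_AppL(3) show ?case
    by cases (use S_AppL(1,2) value_no_step V_Lam V_Itco in blast)+
next
  case (S_AppR s t t')
  from S_AppR(4) show ?case
    by cases (use S_AppR(1-3) value_no_step in blast)+
next
  case (S_ConArg vs t t' D i ts)
  from S_ConArg(4) show ?case
  proof cases
    case (S_ConArg ws s s' ss)
    have "vs = ws \<and> t = s \<and> ts = ss"
      by (rule first_non_value_unique) (use S_ConArg S_ConArg.hyps value_no_step in blast)+
    then show ?thesis
      using S_ConArg S_ConArg.IH by auto
  qed
next
  case (S_CaseArg t t' bs)
  from S_CaseArg(3) show ?case
    by cases (use S_CaseArg(1,2) value_no_step V_Con in blast)+
next
  case (S_ItcoArg g g' A B)
  from S_ItcoArg(3) show ?case
    by cases (use S_ItcoArg(2) in blast)+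
qed

text \<open>By determinism every nonempty reduction from \<open>t\<close> passes through
  \<open>t'\<close>, and \<open>t\<close> itself is not final.\<close>

lemma terminates_step: "t \<leadsto> t' \<Longrightarrow> terminates t \<longleftrightarrow> terminates t'"
  unfolding terminates_def evaluates_to_def
  by (metis converse_rtranclpE converse_rtranclp_into_rtranclp step_deterministic)

lemma terminates_steps: "t \<leadsto>* t' \<Longrightarrow> terminates t \<longleftrightarrow> terminates t'"
  by (induction rule: rtranclp_induct) (auto simp: terminates_step)

lemma not_terminates_step: "\<not> terminates t \<Longrightarrow> \<exists>t'. t \<leadsto> t' \<and> \<not> terminates t'"
  unfolding terminates_def evaluates_to_def
  by (meson converse_rtranclp_into_rtranclp rtranclp.rtrancl_refl)

text \<open>Coinduction principle for divergence: from each member of \<open>X\<close>, at least one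
  step leads to a member of \<open>X\<close> again. In a deterministic system such a reduction is
  the only one and never ends.\<close>

lemma not_terminates_coinduct:
  assumes "t \<in> X" and X: "\<And>t. t \<in> X \<Longrightarrow> \<exists>t'\<in>X. step\<^sup>+\<^sup>+ t t'"
  shows "\<not> terminates t"
proof
  assume "terminates t"
  then obtain r where r: "t \<leadsto>* r" "\<nexists>r'. r \<leadsto> r'"
    unfolding terminates_def evaluates_to_def by blast
  \<comment> \<open>Invariant: a reduct of \<open>t\<close> may lie strictly between two members of
    \<open>X\<close>, but it can always be reduced further to one.\<close>
  have "\<exists>x\<in>X. u \<leadsto>* x" if "t \<leadsto>* u" for u
    using that
  proof (induction rule: rtranclp_induct)
    case base
    then show ?case using assms(1) by blast
  next
    case (step u u')
    then obtain x where x: "x \<in> X" "u \<leadsto>* x" by blast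
    obtain y where y: "y \<in> X" "step\<^sup>+\<^sup>+ x y" using X[OF x(1)] by blast
    have "step\<^sup>+\<^sup>+ u y" using x(2) y(2) by (rule rtranclp_tranclp_tranclp)
    \<comment> \<open>The reduction to \<open>y\<close> is nonempty and, by determinism, begins with
      the given step from \<open>u\<close> to \<open>u'\<close>; hence \<open>u'\<close> still
      reaches \<open>y\<close>.\<close>
    then obtain u'' where "u \<leadsto> u''" "u'' \<leadsto>* y" by (blast dest: tranclpD)
    then show ?case using step(2) y(1) step_deterministic by blast
  qed
  from this[OF r(1)] obtain x where "x \<in> X" "r \<leadsto>* x" by blast
  moreover obtain y where "step\<^sup>+\<^sup>+ x y" using X \<open>x \<in> X\<close> by blast
  ultimately show False using r(2) by (metis rtranclp_tranclp_tranclp tranclpD)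
qed

text \<open>An evaluation context is modelled as any function \<open>E\<close> preserving single
  steps. A divergent term always steps to a divergent term, so the image of the divergent terms
  under \<open>E\<close> serves as the coinduction set.\<close>

lemma not_terminates_context:
  assumes "\<not> terminates t" and E: "\<And>s s'. s \<leadsto> s' \<Longrightarrow> E s \<leadsto> E s'"
  shows "\<not> terminates (E t)"
proof (rule not_terminates_coinduct)
  show "E t \<in> E ` {s. \<not> terminates s}" using assms(1) by blast
  show "\<exists>t'\<in>E ` {s. \<not> terminates s}. step\<^sup>+\<^sup>+ s t'" if "s \<in> E ` {s. \<not> terminates s}" for s
    using that not_terminates_step E by blast
qed

lemma steps_context:
  assumes "t \<leadsto>* t'" and E: "\<And>s s'. s \<leadsto> s' \<Longrightarrow> E s \<leadsto> E s'"
  shows "E t \<leadsto>* E t'"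
  using assms(1) by (induction rule: rtranclp_induct) (auto intro: E rtranclp.rtrancl_into_rtrancl)

text \<open>Follow the reduction to \<open>r\<close>: while it continues, the current term is no
  value, so the reduction to \<open>v\<close> takes the same step; once it stops at
  \<open>r\<close>, nothing but \<open>r\<close> is reachable.\<close>

lemma evaluates_to_value_unique:
  assumes "t \<leadsto>* v" "is_value v" "evaluates_to t r"
  shows "r = v"
proof -
  have "t \<leadsto>* r" and r: "\<nexists>r'. r \<leadsto> r'"
    using assms(3) unfolding evaluates_to_def by auto
  then show ?thesis using assms(1,2)
  proof (induction rule: converse_rtranclp_induct)
    case base
    then show ?case by (metis converse_rtranclpE)
  next
    case (step t u)
    then show ?case by (metis converse_rtranclpE step_deterministic value_no_step)
  qed
qed

section \<open>Outcomes of evaluation and their strict composition\<close>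

text \<open>Divergence is encoded as \<open>None\<close>, so that undefinedness of a partial
  function and nontermination of its program are handled uniformly, with \<open>Option.bind\<close>
  as strict composition.\<close>

definition outcome :: "tm \<Rightarrow> tm option \<Rightarrow> bool" where
  "outcome t r = (case r of None \<Rightarrow> \<not> terminates t | Some v \<Rightarrow> is_value v \<and> t \<leadsto>* v)"

lemma outcome_value: "is_value v \<Longrightarrow> outcome v (Some v)"
  by (simp add: outcome_def)

lemma outcome_steps: "t \<leadsto>* t' \<Longrightarrow> outcome t' r \<Longrightarrow> outcome t r"
  by (auto simp: outcome_def terminates_steps split: option.splits)

lemma outcome_step: "t \<leadsto> t' \<Longrightarrow> outcome t' r \<Longrightarrow> outcome t r"
  using outcome_steps by blast

text \<open>Either \<open>t\<close> diverges and takes \<open>E t\<close> with it, or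
  \<open>E t\<close> reduces to \<open>E w\<close>. The continuation \<open>p\<close> is constrained
  only at the value actually reached.\<close>

lemma outcome_context:
  assumes t: "outcome t r" and E: "\<And>s s'. s \<leadsto> s' \<Longrightarrow> E s \<leadsto> E s'"
    and w: "\<And>w. r = Some w \<Longrightarrow> is_value w \<Longrightarrow> outcome (E w) (p w)"
  shows "outcome (E t) (Option.bind r p)"
proof (cases r)
  case None
  then show ?thesis
    using t not_terminates_context[OF _ E] by (simp add: outcome_def)
next
  case (Some w)
  then have "is_value w" "E t \<leadsto>* E w"
    using t steps_context[OF _ E] by (auto simp: outcome_def)
  then show ?thesis using w[OF Some] Some outcome_steps by auto
qed

section \<open>Closed terms\<close>

lemma subst_lift [simp]: "subst k u (lift k t) = t"
  by (induction t arbitrary: k u) (auto intro: map_idI)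

text \<open>All free indices of \<open>t\<close> lie below \<open>length \<Gamma>\<close>, hence
  below \<open>k\<close>. The inequality survives binders, which raise both sides by one.\<close>

lemma subst_closed': "\<Gamma> \<turnstile> t : A \<Longrightarrow> length \<Gamma> \<le> k \<Longrightarrow> subst k u t = t"
proof (induction arbitrary: k u rule: has_type.induct)
  case (T_Con i D \<Gamma> ts)
  then show ?case by (auto simp: list_all2_conv_all_nth in_set_conv_nth intro!: map_idI)
next
  case (T_Case \<Gamma> t D C bs)
  then show ?case by (auto simp: list_all2_conv_all_nth in_set_conv_nth intro!: map_idI)
qed auto

lemma subst_closed: "[] \<turnstile> t : A \<Longrightarrow> subst k u t = t"
  by (rule subst_closed') auto

text \<open>The extra types go to the outer end of the context, so no de Bruijn index changes and
  \<open>t\<close> needs no lifting.\<close>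

lemma weakening: "\<Gamma> \<turnstile> t : A \<Longrightarrow> \<Gamma> @ \<Delta> \<turnstile> t : A"
proof (induction rule: has_type.induct)
  case (T_Var i \<Gamma>)
  then show ?case using has_type.T_Var[of i "\<Gamma> @ \<Delta>"] by (simp add: nth_append)
next
  case (T_Con i D \<Gamma> ts)
  then show ?case by (auto intro!: has_type.T_Con elim!: list_all2_mono)
next
  case (T_Case \<Gamma> t D C bs)
  then show ?case by (auto intro!: has_type.T_Case[where D = D] elim!: list_all2_mono)
qed (auto intro: has_type.intros)

lemma closed_weakening: "[] \<turnstile> t : A \<Longrightarrow> \<Gamma> \<turnstile> t : A"
  using weakening[of "[]" t A \<Gamma>] by simp

lemma T_Var': "i < length \<Gamma> \<Longrightarrow> \<Gamma> ! i = A \<Longrightarrow> \<Gamma> \<turnstile> Var i : A"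
  using T_Var by blast

lemma T_zero: "\<Gamma> \<turnstile> zero_tm : TNat"
  by (rule T_Con) auto

lemma T_succ: "\<Gamma> \<turnstile> t : TNat \<Longrightarrow> \<Gamma> \<turnstile> succ_tm t : TNat"
  by (rule T_Con) auto

lemma T_unit: "\<Gamma> \<turnstile> Con unit_decl 0 [] : TUnit"
  by (rule T_Con) auto

lemma T_pair: "\<Gamma> \<turnstile> s : A \<Longrightarrow> \<Gamma> \<turnstile> t : B \<Longrightarrow> \<Gamma> \<turnstile> pair_tm A B s t : A \<otimes> B"
  by (rule T_Con) auto

lemma T_inl: "\<Gamma> \<turnstile> t : A \<Longrightarrow> \<Gamma> \<turnstile> inl_tm A B t : A \<oplus> B"
  by (rule T_Con) auto

lemma T_inr: "\<Gamma> \<turnstile> t : B \<Longrightarrow> \<Gamma> \<turnstile> inr_tm A B t : A \<oplus> B"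
  by (rule T_Con) auto

lemma T_Case_prod: "\<Gamma> \<turnstile> t : A \<otimes> B \<Longrightarrow> \<Gamma> \<turnstile> b : A \<rightarrow> B \<rightarrow> C \<Longrightarrow> \<Gamma> \<turnstile> Case t [b] : C"
  by (rule T_Case) auto

lemma T_Case_nat:
  "\<Gamma> \<turnstile> t : TNat \<Longrightarrow> \<Gamma> \<turnstile> b : C \<Longrightarrow> \<Gamma> \<turnstile> c : TNat \<rightarrow> C \<Longrightarrow> \<Gamma> \<turnstile> Case t [b, c] : C"
  by (rule T_Case) auto

lemma is_value_numeral [simp]: "is_value (numeral_tm k)"
  by (induction k) auto

lemma numeral_tm_inject [simp]: "numeral_tm k = numeral_tm l \<longleftrightarrow> k = l"
proof (induction k arbitrary: l)
  case 0
  then show ?case by (cases l) auto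
next
  case (Suc k)
  then show ?case by (cases l) auto
qed

lemma is_value_tuple [simp]: "is_value (tuple_tm xs)"
  by (induction xs rule: tuple_tm.induct) auto

section \<open>Combinators\<close>

text \<open>Being a value lets \<open>t\<close> stand in function position without further
  evaluation; being closed makes it invariant under substitution and typable in every
  context.\<close>

definition arrow :: "tm \<Rightarrow> ty \<Rightarrow> ty \<Rightarrow> bool" where
  "arrow t A B \<longleftrightarrow> is_value t \<and> [] \<turnstile> t : A \<rightarrow> B"

lemma arrow_value: "arrow t A B \<Longrightarrow> is_value t"
  and arrow_type: "arrow t A B \<Longrightarrow> \<Gamma> \<turnstile> t : A \<rightarrow> B"
  and arrow_subst: "arrow t A B \<Longrightarrow> subst k u t = t"
  by (auto simp: arrow_def intro: closed_weakening subst_closed)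

text \<open>Here and in the next combinators the given terms are put under binders without lifting,
  which is sound because they are only used with closed terms.\<close>

definition const_tm :: "ty \<Rightarrow> tm \<Rightarrow> tm" where
  "const_tm A c = Lam A c"

definition id_tm :: "ty \<Rightarrow> tm" where
  "id_tm A = Lam A (Var 0)"

definition comp_tm :: "ty \<Rightarrow> tm \<Rightarrow> tm \<Rightarrow> tm" where
  "comp_tm A g f = Lam A (App g (App f (Var 0)))"

definition fork_tm :: "ty \<Rightarrow> ty \<Rightarrow> ty \<Rightarrow> tm \<Rightarrow> tm \<Rightarrow> tm" where
  "fork_tm A B C f g = Lam A (pair_tm B C (App f (Var 0)) (App g (Var 0)))"

definition fst_tm :: "ty \<Rightarrow> ty \<Rightarrow> tm" where
  "fst_tm A B = Lam (A \<otimes> B) (Case (Var 0) [Lam A (Lam B (Var 1))])"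

definition snd_tm :: "ty \<Rightarrow> ty \<Rightarrow> tm" where
  "snd_tm A B = Lam (A \<otimes> B) (Case (Var 0) [Lam A (Lam B (Var 0))])"

definition succ_fun_tm :: tm where
  "succ_fun_tm = Lam TNat (succ_tm (Var 0))"

definition inl_fun_tm :: "ty \<Rightarrow> ty \<Rightarrow> tm" where
  "inl_fun_tm A B = Lam A (inl_tm A B (Var 0))"

definition inr_fun_tm :: "ty \<Rightarrow> ty \<Rightarrow> tm" where
  "inr_fun_tm A B = Lam B (inr_tm A B (Var 0))"

text \<open>Maps \<open>(0, c)\<close> to \<open>z c\<close> and \<open>(k + 1, c)\<close> to
  \<open>s (k, c)\<close>. Branches of \<open>Case\<close> are not evaluated before selection, so a
  divergent branch that is not chosen does no harm. In the successor branch \<open>Var 0\<close> is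
  the predecessor and \<open>Var 1\<close> the datum \<open>c\<close>.\<close>

definition nat_case_tm :: "ty \<Rightarrow> tm \<Rightarrow> tm \<Rightarrow> tm" where
  "nat_case_tm C z s = Lam (TNat \<otimes> C) (Case (Var 0)
     [Lam TNat (Lam C (Case (Var 1)
        [App z (Var 0), Lam TNat (App s (pair_tm TNat C (Var 0) (Var 1)))]))])"

section \<open>Typing of the combinators\<close>

lemma arrow_Lam: "[A] \<turnstile> t : B \<Longrightarrow> arrow (Lam A t) A B"
  by (auto simp: arrow_def intro: T_Lam)

lemma arrow_const: "[] \<turnstile> c : B \<Longrightarrow> arrow (const_tm A c) A B"
  by (auto simp: const_tm_def intro: arrow_Lam closed_weakening)

lemma arrow_id: "arrow (id_tm A) A A"
  by (auto simp: id_tm_def intro!: arrow_Lam T_Var')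

lemma arrow_comp: "arrow g B C \<Longrightarrow> arrow f A B \<Longrightarrow> arrow (comp_tm A g f) A C"
  by (auto simp: comp_tm_def
      intro!: arrow_Lam T_App[OF arrow_type[of g B C]] T_App[OF arrow_type[of f A B]] T_Var')

lemma arrow_fork: "arrow f A B \<Longrightarrow> arrow g A C \<Longrightarrow> arrow (fork_tm A B C f g) A (B \<otimes> C)"
  by (auto simp: fork_tm_def intro!: arrow_Lam T_Var' T_pair intro: T_App arrow_type)

lemma arrow_fst: "arrow (fst_tm A B) (A \<otimes> B) A"
  by (auto simp: fst_tm_def intro!: arrow_Lam T_Lam T_Var' T_Case_prod[where A = A and B = B])

lemma arrow_snd: "arrow (snd_tm A B) (A \<otimes> B) B"
  by (auto simp: snd_tm_def intro!: arrow_Lam T_Lam T_Var' T_Case_prod[where A = A and B = B])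

lemma arrow_succ_fun: "arrow succ_fun_tm TNat TNat"
  by (auto simp: succ_fun_tm_def simp del: One_nat_def intro!: arrow_Lam T_Var' T_succ)

lemma arrow_inl_fun: "arrow (inl_fun_tm A B) A (A \<oplus> B)"
  by (auto simp: inl_fun_tm_def intro!: arrow_Lam T_Var' T_inl)

lemma arrow_inr_fun: "arrow (inr_fun_tm A B) B (A \<oplus> B)"
  by (auto simp: inr_fun_tm_def simp del: One_nat_def intro!: arrow_Lam T_Var' T_inr)

lemma arrow_nat_case:
  "arrow z C B \<Longrightarrow> arrow s (TNat \<otimes> C) B \<Longrightarrow> arrow (nat_case_tm C z s) (TNat \<otimes> C) B"
  by (auto simp: nat_case_tm_def intro!: arrow_Lam T_Lam T_Var' T_pair T_Case_nat
      T_Case_prod[where A = TNat and B = C]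
      T_App[OF arrow_type[of z C B]] T_App[OF arrow_type[of s "TNat \<otimes> C" B]])

lemma arrow_Itco: "arrow g A (A \<oplus> B) \<Longrightarrow> arrow (Itco A B g) A B"
  by (auto simp: arrow_def intro: T_Itco)

lemmas arrow_intros = arrow_const arrow_id arrow_comp arrow_fork arrow_fst arrow_snd
  arrow_succ_fun arrow_inl_fun arrow_inr_fun arrow_nat_case arrow_Itco T_zero T_unit

section \<open>Evaluation of the combinators\<close>

lemma outcome_Beta: "is_value v \<Longrightarrow> outcome (subst 0 v t) r \<Longrightarrow> outcome (App (Lam A t) v) r"
  by (rule outcome_step[OF S_Beta])

lemma outcome_Case:
  assumes "\<forall>v\<in>set vs. is_value v" "i < length bs" "outcome (foldl App (bs ! i) vs) r"
  shows "outcome (Case (Con D i vs) bs) r"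
  using outcome_step[OF S_Case] assms by blast

lemma outcome_AppR:
  assumes "outcome t r" "is_value s" "\<And>w. r = Some w \<Longrightarrow> is_value w \<Longrightarrow> outcome (App s w) (p w)"
  shows "outcome (App s t) (Option.bind r p)"
  using outcome_context[of t r "App s" p] assms S_AppR by blast

lemma outcome_CaseArg:
  assumes "outcome t r" "\<And>w. r = Some w \<Longrightarrow> is_value w \<Longrightarrow> outcome (Case w bs) (p w)"
  shows "outcome (Case t bs) (Option.bind r p)"
  using outcome_context[of t r "\<lambda>t. Case t bs" p] assms S_CaseArg by blast

text \<open>Both components are evaluated, from left to right, so the pair diverges if either does.
  The rule \<open>S_ConArg\<close> is used with an empty prefix of values for the first component
  and with \<open>[v]\<close> for the second.\<close>

lemma outcome_pair:
  assumes "outcome s r" "outcome t q"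
  shows "outcome (pair_tm A B s t)
    (Option.bind r (\<lambda>v. Option.bind q (\<lambda>w. Some (pair_tm A B v w))))"
proof (rule outcome_context[of s r "\<lambda>s. pair_tm A B s t"])
  show "pair_tm A B u t \<leadsto> pair_tm A B u' t" if "u \<leadsto> u'" for u u'
    using S_ConArg[of "[]"] that by simp
  fix v assume v: "is_value v"
  show "outcome (pair_tm A B v t) (Option.bind q (\<lambda>w. Some (pair_tm A B v w)))"
  proof (rule outcome_context[of t q "\<lambda>t. pair_tm A B v t"])
    show "pair_tm A B v u \<leadsto> pair_tm A B v u'" if "u \<leadsto> u'" for u u'
      using S_ConArg[of "[v]"] that v by simp
  qed (use assms v in \<open>auto intro: outcome_value\<close>)
qed (rule assms)

lemma run_const:
  "is_value v \<Longrightarrow> [] \<turnstile> c : B \<Longrightarrow> is_value c \<Longrightarrow> outcome (App (const_tm A c) v) (Some c)"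
  by (auto simp: const_tm_def subst_closed intro!: outcome_Beta outcome_value)

lemma run_id: "is_value v \<Longrightarrow> outcome (App (id_tm A) v) (Some v)"
  by (auto simp: id_tm_def intro!: outcome_Beta outcome_value)

lemma run_comp:
  assumes "arrow g B C" "arrow f A B" "is_value v" "outcome (App f v) r"
    and "\<And>w. r = Some w \<Longrightarrow> is_value w \<Longrightarrow> outcome (App g w) (p w)"
  shows "outcome (App (comp_tm A g f) v) (Option.bind r p)"
  unfolding comp_tm_def using assms
  by (auto simp: arrow_subst intro!: outcome_Beta outcome_AppR arrow_value)

text \<open>Variant of \<open>run_comp\<close> whose conclusion is not a bind, so that it matches an
  arbitrary outcome of the outer function.\<close>

lemma run_comp_Some:
  assumes "arrow g B C" "arrow f A B" "is_value v" "outcome (App f v) (Some w)"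
    and "outcome (App g w) r"
  shows "outcome (App (comp_tm A g f) v) r"
  using run_comp[of g B C f A v "Some w" "\<lambda>_. r"] assms by auto

lemma run_comp_None:
  assumes "arrow g B C" "arrow f A B" "is_value v" "outcome (App f v) None"
  shows "outcome (App (comp_tm A g f) v) None"
  using run_comp[OF assms] by auto

lemma run_fork:
  assumes "arrow f A B" "arrow g A C" "is_value v" "outcome (App f v) r" "outcome (App g v) q"
  shows "outcome (App (fork_tm A B C f g) v)
    (Option.bind r (\<lambda>v. Option.bind q (\<lambda>w. Some (pair_tm B C v w))))"
  unfolding fork_tm_def using assms
  by (auto simp: arrow_subst intro!: outcome_Beta outcome_pair)

lemma run_fork_Some:
  assumes "arrow f A B" "arrow g A C" "is_value v"
    and "outcome (App f v) (Some a)" "outcome (App g v) (Some b)"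
  shows "outcome (App (fork_tm A B C f g) v) (Some (pair_tm B C a b))"
  using run_fork[OF assms] by simp

text \<open>Meant for the branches of pair constructors, which take their two arguments one at a
  time. The \<open>lift\<close> of \<open>v\<close> comes from passing under the inner binder;
  substituting \<open>w\<close> then cancels it by \<open>subst_lift\<close>.\<close>

lemma outcome_App2:
  assumes "is_value v" "is_value w" "outcome (subst 0 w (subst (Suc 0) (lift 0 v) t)) r"
  shows "outcome (App (App (Lam A (Lam B t)) v) w) r"
proof -
  have "App (App (Lam A (Lam B t)) v) w \<leadsto> App (subst 0 v (Lam B t)) w"
    using assms(1) by (intro S_AppL S_Beta)
  then show ?thesis using assms by (auto intro: outcome_step outcome_Beta)
qed

lemma run_fst: "is_value v \<Longrightarrow> is_value w \<Longrightarrow> outcome (App (fst_tm A B) (pair_tm A B v w)) (Some v)"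
  by (auto simp: fst_tm_def intro!: outcome_Beta outcome_Case outcome_App2 outcome_value)

lemma run_snd: "is_value v \<Longrightarrow> is_value w \<Longrightarrow> outcome (App (snd_tm A B) (pair_tm A B v w)) (Some w)"
  by (auto simp: snd_tm_def intro!: outcome_Beta outcome_Case outcome_App2 outcome_value)

lemma run_succ_fun: "is_value v \<Longrightarrow> outcome (App succ_fun_tm v) (Some (succ_tm v))"
  by (auto simp: succ_fun_tm_def intro!: outcome_Beta outcome_value)

lemma run_inl_fun: "is_value v \<Longrightarrow> outcome (App (inl_fun_tm A B) v) (Some (inl_tm A B v))"
  by (auto simp: inl_fun_tm_def intro!: outcome_Beta outcome_value)

lemma run_inr_fun: "is_value v \<Longrightarrow> outcome (App (inr_fun_tm A B) v) (Some (inr_tm A B v))"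
  by (auto simp: inr_fun_tm_def intro!: outcome_Beta outcome_value)

lemma run_nat_case_zero:
  assumes "arrow z C B" "arrow s (TNat \<otimes> C) B" "is_value v" "outcome (App z v) r"
  shows "outcome (App (nat_case_tm C z s) (pair_tm TNat C zero_tm v)) r"
  unfolding nat_case_tm_def using assms
  by (auto simp: arrow_subst intro!: outcome_Beta outcome_Case outcome_App2)

lemma run_nat_case_succ:
  assumes "arrow z C B" "arrow s (TNat \<otimes> C) B" "is_value k" "is_value v"
    and "outcome (App s (pair_tm TNat C k v)) r"
  shows "outcome (App (nat_case_tm C z s) (pair_tm TNat C (succ_tm k) v)) r"
  unfolding nat_case_tm_def using assms
  by (auto simp: arrow_subst intro!: outcome_Beta outcome_Case outcome_App2)

section \<open>Evaluation of loops\<close>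

lemma run_Itco_inl:
  assumes "is_value g" "is_value v" "outcome (App g v) (Some (inl_tm A B w))"
    and "outcome (App (Itco A B g) w) r"
  shows "outcome (App (Itco A B g) v) r"
  using assms by (auto simp: outcome_def[of "App g v"] intro: outcome_steps itco_inl)

lemma run_Itco_inr:
  assumes "is_value g" "is_value v" "outcome (App g v) (Some (inr_tm A B w))"
  shows "outcome (App (Itco A B g) v) (Some w)"
  using assms by (auto simp: outcome_def intro: itco_inr)

text \<open>After unfolding, the call of \<open>g\<close> is the scrutinee of a case distinction, an
  evaluation position, so its divergence propagates.\<close>

lemma run_Itco_None:
  assumes "is_value g" "is_value v" "outcome (App g v) None"
  shows "outcome (App (Itco A B g) v) None"
proof (rule outcome_step[OF S_Itco])
  show "outcome (Case (App g v) [Itco A B g, Lam B (Var 0)]) None"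
    using outcome_CaseArg[OF assms(3)] by auto
qed (use assms in auto)

text \<open>Coinduction over the loop applied to the states in \<open>X\<close>: each round starts
  with an \<open>S_Itco\<close> step, so it takes at least one step, and ends in a state of
  \<open>X\<close> again.\<close>

lemma run_Itco_forever:
  assumes "is_value g" "v \<in> X"
    and X: "\<And>v. v \<in> X \<Longrightarrow> is_value v \<and> (\<exists>w\<in>X. outcome (App g v) (Some (inl_tm A B w)))"
  shows "outcome (App (Itco A B g) v) None"
proof -
  have "\<not> terminates (App (Itco A B g) v)"
  proof (rule not_terminates_coinduct)
    show "App (Itco A B g) v \<in> App (Itco A B g) ` X" using assms(2) by blast
    fix t assume "t \<in> App (Itco A B g) ` X"
    then obtain v where v: "v \<in> X" "t = App (Itco A B g) v" by blast
    obtain w where w: "w \<in> X" "App g v \<leadsto>* inl_tm A B w" "is_value w"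
      using X[OF v(1)] by (auto simp: outcome_def)
    let ?bs = "[Itco A B g, Lam B (Var 0)]"
    have "t \<leadsto> Case (App g v) ?bs"
      using X[OF v(1)] assms(1) unfolding v(2) by (intro S_Itco) auto
    moreover have "Case (App g v) ?bs \<leadsto>* Case (inl_tm A B w) ?bs"
      using w(2) by (rule steps_CaseArg)
    moreover have "Case (inl_tm A B w) ?bs \<leadsto> App (Itco A B g) w"
      using S_Case[of "[w]" 0 ?bs] w(3) by simp
    ultimately have "step\<^sup>+\<^sup>+ t (App (Itco A B g) w)"
      by (meson rtranclp_into_tranclp2 rtranclp.rtrancl_into_rtrancl)
    then show "\<exists>t'\<in>App (Itco A B g) ` X. step\<^sup>+\<^sup>+ t t'"
      using w(1) by blast
  qed
  then show ?thesis by (simp add: outcome_def)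
qed

section \<open>Realizability of the partial recursive functions\<close>

text \<open>
  Since \<open>\<nat>\<^sup>1\<close> is \<open>\<nat>\<close> and not \<open>\<nat> \<times> 1\<close>, adding and removing a first component has to be
  done by coercions that depend on the arity.
\<close>

definition cons_tm :: "nat \<Rightarrow> tm" where
  "cons_tm n = (if n = 0 then fst_tm TNat TUnit else id_tm (TNat \<otimes> nat_pow n))"

definition uncons_tm :: "nat \<Rightarrow> tm" where
  "uncons_tm n = (if n = 0
     then fork_tm TNat TNat TUnit (id_tm TNat) (const_tm TNat (Con unit_decl 0 []))
     else id_tm (TNat \<otimes> nat_pow n))"

abbreviation split_tuple :: "nat \<Rightarrow> nat list \<Rightarrow> tm" where
  "split_tuple x xs \<equiv> pair_tm TNat (nat_pow (length xs)) (numeral_tm x) (tuple_tm xs)"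

lemma arrow_cons: "arrow (cons_tm n) (TNat \<otimes> nat_pow n) (nat_pow (Suc n))"
  by (cases n) (auto simp: cons_tm_def intro: arrow_intros)

lemma arrow_uncons: "arrow (uncons_tm n) (nat_pow (Suc n)) (TNat \<otimes> nat_pow n)"
  by (cases n) (auto simp: uncons_tm_def intro!: arrow_intros)

lemma run_cons:
  "outcome (App (cons_tm (length xs)) (split_tuple x xs)) (Some (tuple_tm (x # xs)))"
  by (cases xs) (auto simp: cons_tm_def intro: run_fst run_id)

lemma run_uncons:
  "outcome (App (uncons_tm (length xs)) (tuple_tm (x # xs))) (Some (split_tuple x xs))"
  by (cases xs) (auto simp: uncons_tm_def intro!: run_fork_Some run_const run_id arrow_intros)

definition realizes :: "tm \<Rightarrow> nat \<Rightarrow> pfun \<Rightarrow> bool" where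
  "realizes t n f \<longleftrightarrow> arrow t (nat_pow n) TNat \<and>
     (\<forall>xs. length xs = n \<longrightarrow> outcome (App t (tuple_tm xs)) (map_option numeral_tm (f xs)))"

lemma realizes_arrow: "realizes t n f \<Longrightarrow> arrow t (nat_pow n) TNat"
  and realizes_run: "realizes t n f \<Longrightarrow> length xs = n \<Longrightarrow>
    outcome (App t (tuple_tm xs)) (map_option numeral_tm (f xs))"
  by (auto simp: realizes_def)

lemma realizes_zero: "realizes (const_tm (nat_pow n) zero_tm) n (\<lambda>xs. Some 0)"
  by (auto simp: realizes_def intro!: arrow_intros run_const)

lemma realizes_succ: "realizes succ_fun_tm 1 (\<lambda>xs. Some (Suc (xs ! 0)))"
  using run_succ_fun[OF is_value_numeral]
  by (auto simp: realizes_def length_Suc_conv intro: arrow_succ_fun)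

section \<open>Projections and composition\<close>

text \<open>Component \<open>i + 1\<close> of a tuple is component \<open>i\<close> of its tail. The
  arity drops with the index, so \<open>n\<close> is generalized in the induction.\<close>

lemma realizable_proj: "i < n \<Longrightarrow> \<exists>t. realizes t n (\<lambda>xs. Some (xs ! i))"
proof (induction i arbitrary: n)
  case 0
  then obtain m where n: "n = Suc m" by (cases n) auto
  let ?t = "comp_tm (nat_pow n) (fst_tm TNat (nat_pow m)) (uncons_tm m)"
  have "outcome (App ?t (tuple_tm xs)) (Some (numeral_tm (xs ! 0)))" if len: "length xs = n" for xs
  proof -
    obtain x ys where xs: "xs = x # ys" "length ys = m" using len n by (cases xs) auto
    show ?thesis
      using run_uncons[of ys x] run_fst[of "numeral_tm x" "tuple_tm ys"] xs(2) unfolding n xs(1)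
      by (auto intro!: run_comp_Some[OF arrow_fst arrow_uncons])
  qed
  moreover have "arrow ?t (nat_pow n) TNat"
    unfolding n by (rule arrow_comp[OF arrow_fst arrow_uncons])
  ultimately show ?case unfolding realizes_def by auto
next
  case (Suc i)
  then obtain m where n: "n = Suc m" and "i < m" by (cases n) auto
  then obtain t where t: "realizes t m (\<lambda>xs. Some (xs ! i))" using Suc.IH by blast
  let ?d = "comp_tm (nat_pow n) (snd_tm TNat (nat_pow m)) (uncons_tm m)"
  have d: "arrow ?d (nat_pow n) (nat_pow m)"
    unfolding n by (rule arrow_comp[OF arrow_snd arrow_uncons])
  have "outcome (App (comp_tm (nat_pow n) t ?d) (tuple_tm xs)) (Some (numeral_tm (xs ! Suc i)))"
    if len: "length xs = n" for xs
  proof -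
    obtain x ys where xs: "xs = x # ys" "length ys = m" using len n by (cases xs) auto
    have "outcome (App ?d (tuple_tm xs)) (Some (tuple_tm ys))"
      using run_uncons[of ys x] run_snd[of "numeral_tm x" "tuple_tm ys"] xs(2) unfolding n xs(1)
      by (auto intro!: run_comp_Some[OF arrow_snd arrow_uncons])
    moreover have "outcome (App t (tuple_tm ys)) (Some (numeral_tm (xs ! Suc i)))"
      using realizes_run[OF t xs(2)] xs(1) by simp
    ultimately show ?thesis
      using run_comp_Some[OF realizes_arrow[OF t] d] by auto
  qed
  then show ?case
    using arrow_comp[OF realizes_arrow[OF t] d] unfolding realizes_def by auto
qed

text \<open>Collects the inner functions of a composition into one program. Strictness of pairing
  makes it diverge as soon as one of them is undefined, which is the definedness condition of
  \<open>pcomp\<close>.\<close>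

lemma realizable_tuple:
  assumes "\<forall>g\<in>set gs. \<exists>t. realizes t n g"
  shows "\<exists>t. arrow t (nat_pow n) (nat_pow (length gs)) \<and> (\<forall>xs. length xs = n \<longrightarrow>
    outcome (App t (tuple_tm xs)) (if \<forall>g\<in>set gs. g xs \<noteq> None
      then Some (tuple_tm (map (\<lambda>g. the (g xs)) gs)) else None))"
  using assms
proof (induction gs)
  case Nil
  have "arrow (const_tm (nat_pow n) (Con unit_decl 0 [])) (nat_pow n) (nat_pow 0)"
    by (auto intro!: arrow_intros)
  then show ?case by (auto intro!: exI run_const T_unit)
next
  case (Cons g gs)
  then obtain t where t: "arrow t (nat_pow n) (nat_pow (length gs))"
    and run_t: "\<And>xs. length xs = n \<Longrightarrow> outcome (App t (tuple_tm xs))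
      (if \<forall>g\<in>set gs. g xs \<noteq> None then Some (tuple_tm (map (\<lambda>g. the (g xs)) gs)) else None)"
    by auto
  obtain u where u: "realizes u n g" using Cons.prems by auto
  let ?f = "fork_tm (nat_pow n) TNat (nat_pow (length gs)) u t"
  have f: "arrow ?f (nat_pow n) (TNat \<otimes> nat_pow (length gs))"
    using realizes_arrow[OF u] t by (rule arrow_fork)
  have "outcome (App (comp_tm (nat_pow n) (cons_tm (length gs)) ?f) (tuple_tm xs))
    (if \<forall>h\<in>set (g # gs). h xs \<noteq> None
      then Some (tuple_tm (map (\<lambda>h. the (h xs)) (g # gs))) else None)" if xs: "length xs = n" for xs
  proof -
    note fork = run_fork[OF realizes_arrow[OF u] t is_value_tuple realizes_run[OF u xs] run_t[OF xs]]
    show ?thesis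
    proof (cases "\<forall>h\<in>set (g # gs). h xs \<noteq> None")
      case True
      let ?ys = "map (\<lambda>g. the (g xs)) gs"
      have "outcome (App ?f (tuple_tm xs)) (Some (split_tuple (the (g xs)) ?ys))"
        using fork True by auto
      moreover have "outcome (App (cons_tm (length gs)) (split_tuple (the (g xs)) ?ys))
          (Some (tuple_tm (the (g xs) # ?ys)))"
        using run_cons[of ?ys "the (g xs)"] by simp
      ultimately show ?thesis
        using run_comp_Some[OF arrow_cons f is_value_tuple] True by auto
    next
      case False
      \<comment> \<open>Either \<open>g\<close> is undefined at \<open>xs\<close>, or it is defined
        and some member of \<open>gs\<close> is not; the fork diverges in both cases.\<close>
      then have "outcome (App ?f (tuple_tm xs)) None"
        using fork by (cases "g xs") (auto split: if_splits)
      then show ?thesis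
        using run_comp_None[OF arrow_cons f is_value_tuple] False by auto
    qed
  qed
  then show ?case
    using arrow_comp[OF arrow_cons f] unfolding length_Cons by blast
qed

lemma realizable_pcomp:
  assumes "realizes t (length gs) f" "\<forall>g\<in>set gs. \<exists>u. realizes u n g"
  shows "\<exists>t. realizes t n (pcomp f gs)"
proof -
  obtain u where u: "arrow u (nat_pow n) (nat_pow (length gs))"
    and run_u: "\<And>xs. length xs = n \<Longrightarrow> outcome (App u (tuple_tm xs))
      (if \<forall>g\<in>set gs. g xs \<noteq> None then Some (tuple_tm (map (\<lambda>g. the (g xs)) gs)) else None)"
    using realizable_tuple[OF assms(2)] by blast
  have "outcome (App (comp_tm (nat_pow n) t u) (tuple_tm xs)) (map_option numeral_tm (pcomp f gs xs))"
    if xs: "length xs = n" for xs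
  proof (cases "\<forall>g\<in>set gs. g xs \<noteq> None")
    case True
    have "outcome (App t (tuple_tm (map (\<lambda>g. the (g xs)) gs))) (map_option numeral_tm (pcomp f gs xs))"
      using realizes_run[OF assms(1)] True by (simp add: pcomp_def)
    with run_u[OF xs] True show ?thesis
      using run_comp_Some[OF realizes_arrow[OF assms(1)] u is_value_tuple] by auto
  next
    case False
    then have "outcome (App u (tuple_tm xs)) None" "pcomp f gs xs = None"
      using run_u[OF xs] by (auto simp: pcomp_def split: if_splits)
    then show ?thesis
      using run_comp_None[OF realizes_arrow[OF assms(1)] u is_value_tuple] by simp
  qed
  then show ?thesis
    using arrow_comp[OF realizes_arrow[OF assms(1)] u] unfolding realizes_def by auto
qed

section \<open>Primitive recursion\<close>

text \<open>The sum \<open>k + i\<close> stays equal to the recursion argument and \<open>r\<close>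
  stays equal to the value at \<open>i\<close>, so \<open>r\<close> is the answer when
  \<open>k\<close> reaches zero. If a stage is undefined, the round computing it diverges.\<close>

lemma realizable_prec:
  assumes f: "realizes f n F" and g: "realizes g (n + 2) G"
  shows "\<exists>t. realizes t (n + 1) (\<lambda>xs. prec F G (hd xs) (tl xs))"
proof -
  let ?P = "nat_pow n"
  let ?R = "TNat \<otimes> ?P"
  let ?I = "TNat \<otimes> ?R"
  let ?S = "TNat \<otimes> ?I"
  \<comment> \<open>The countdown \<open>k\<close> is the outermost component, so
    \<open>nat_case_tm\<close> can branch on it directly.\<close>
  define state where "state k i r xs = pair_tm TNat ?I (numeral_tm k)
    (pair_tm TNat ?R (numeral_tm i) (pair_tm TNat ?P (numeral_tm r) (tuple_tm xs)))" for k i r xs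
  \<comment> \<open>Turns the nested pairs \<open>(i, r, xs)\<close> into the tuple of arity
    \<open>n + 2\<close> on which \<open>g\<close> operates; the coercions matter when
    \<open>n = 0\<close>.\<close>
  define flat where "flat = comp_tm ?I (cons_tm (n + 1)) (fork_tm ?I TNat (nat_pow (n + 1))
    (fst_tm TNat ?R) (comp_tm ?I (cons_tm n) (snd_tm TNat ?R)))"
  define g' where "g' = comp_tm ?I g flat"
  define next_acc where "next_acc = fork_tm ?I TNat ?P g'
    (comp_tm ?I (snd_tm TNat ?P) (snd_tm TNat ?R))"
  define next_idx where "next_idx = fork_tm ?I TNat ?R
    (comp_tm ?I succ_fun_tm (fst_tm TNat ?R)) next_acc"
  \<comment> \<open>The first component is kept as it is: \<open>nat_case_tm\<close> has already
    replaced \<open>k + 1\<close> by \<open>k\<close>.\<close>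
  define next_state where "next_state = fork_tm ?S TNat ?I
    (fst_tm TNat ?I) (comp_tm ?S next_idx (snd_tm TNat ?I))"
  define finish where "finish = comp_tm ?I (inr_fun_tm ?S TNat)
    (comp_tm ?I (fst_tm TNat ?P) (snd_tm TNat ?R))"
  define body where "body = nat_case_tm ?I finish (comp_tm ?S (inl_fun_tm ?S TNat) next_state)"
  \<comment> \<open>Sends \<open>(x, xs)\<close> to the state with \<open>x\<close> rounds left,
    index \<open>0\<close> and accumulator \<open>F xs\<close>; it diverges when \<open>F xs\<close>
    is undefined.\<close>
  define start where "start = fork_tm ?R TNat ?I (fst_tm TNat ?P)
    (fork_tm ?R TNat ?R (const_tm ?R zero_tm)
      (fork_tm ?R TNat ?P (comp_tm ?R f (snd_tm TNat ?P)) (snd_tm TNat ?P)))"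
  define t where "t = comp_tm (nat_pow (n + 1)) (Itco ?S TNat body)
    (comp_tm (nat_pow (n + 1)) start (uncons_tm n))"

  note af = realizes_arrow[OF f] and ag = realizes_arrow[OF g]
  have a_cons: "arrow (cons_tm (n + 1)) (TNat \<otimes> nat_pow (n + 1)) (nat_pow (n + 2))"
    using arrow_cons[of "n + 1"] by simp
  have a_cons': "arrow (cons_tm n) ?R (nat_pow (n + 1))"
    using arrow_cons[of n] by simp
  have a_uncons: "arrow (uncons_tm n) (nat_pow (n + 1)) ?R"
    using arrow_uncons[of n] by simp
  have a_tl: "arrow (comp_tm ?I (cons_tm n) (snd_tm TNat ?R)) ?I (nat_pow (n + 1))"
    by (rule arrow_comp[OF a_cons' arrow_snd])
  have a_flat: "arrow flat ?I (nat_pow (n + 2))"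
    unfolding flat_def by (rule arrow_comp[OF a_cons arrow_fork[OF arrow_fst a_tl]])
  have a_g': "arrow g' ?I TNat"
    unfolding g'_def by (rule arrow_comp[OF ag a_flat])
  have a_next_acc: "arrow next_acc ?I ?R"
    unfolding next_acc_def by (rule arrow_fork[OF a_g' arrow_comp[OF arrow_snd arrow_snd]])
  have a_next_idx: "arrow next_idx ?I ?I"
    unfolding next_idx_def
    by (rule arrow_fork[OF arrow_comp[OF arrow_succ_fun arrow_fst] a_next_acc])
  have a_next_state: "arrow next_state ?S ?S"
    unfolding next_state_def by (rule arrow_fork[OF arrow_fst arrow_comp[OF a_next_idx arrow_snd]])
  have a_finish: "arrow finish ?I (?S \<oplus> TNat)"
    unfolding finish_def by (rule arrow_comp[OF arrow_inr_fun arrow_comp[OF arrow_fst arrow_snd]])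
  have a_inl_next: "arrow (comp_tm ?S (inl_fun_tm ?S TNat) next_state) ?S (?S \<oplus> TNat)"
    by (rule arrow_comp[OF arrow_inl_fun a_next_state])
  have a_body: "arrow body ?S (?S \<oplus> TNat)"
    unfolding body_def by (rule arrow_nat_case[OF a_finish a_inl_next])
  have a_start: "arrow start ?R ?S"
    unfolding start_def by (intro arrow_fork arrow_fst arrow_const T_zero arrow_comp[OF af] arrow_snd)
  have a_init: "arrow (comp_tm (nat_pow (n + 1)) start (uncons_tm n)) (nat_pow (n + 1)) ?S"
    by (rule arrow_comp[OF a_start a_uncons])
  have a_t: "arrow t (nat_pow (n + 1)) TNat"
    unfolding t_def by (rule arrow_comp[OF arrow_Itco[OF a_body] a_init])

  have v_state: "is_value (state k i r xs)" for k i r xs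
    by (simp add: state_def)
  have run_body_0: "outcome (App body (state 0 i r xs)) (Some (inr_tm ?S TNat (numeral_tm r)))"
    for i r xs
  proof -
    let ?u = "pair_tm TNat ?P (numeral_tm r) (tuple_tm xs)"
    let ?v = "pair_tm TNat ?R (numeral_tm i) ?u"
    have v: "is_value ?v" by simp
    have "outcome (App (comp_tm ?I (fst_tm TNat ?P) (snd_tm TNat ?R)) ?v) (Some (numeral_tm r))"
      by (rule run_comp_Some[OF arrow_fst arrow_snd v run_snd run_fst]) auto
    then have "outcome (App finish ?v) (Some (inr_tm ?S TNat (numeral_tm r)))"
      unfolding finish_def
      by (rule run_comp_Some[OF arrow_inr_fun arrow_comp[OF arrow_fst arrow_snd] v])
        (rule run_inr_fun[OF is_value_numeral])
    from run_nat_case_zero[OF a_finish a_inl_next v this]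
    show ?thesis unfolding body_def state_def numeral_tm.simps .
  qed
  \<comment> \<open>One round performs one recursion step; \<open>map_option\<close> also covers an
    undefined value of \<open>G\<close>, where the round diverges.\<close>
  have run_body_Suc: "outcome (App body (state (Suc k) i r xs))
      (map_option (\<lambda>r'. inl_tm ?S TNat (state k (Suc i) r' xs)) (G (i # r # xs)))"
    if len: "length xs = n" for k i r xs
  proof -
    define v where "v = pair_tm TNat ?R (numeral_tm i) (pair_tm TNat ?P (numeral_tm r) (tuple_tm xs))"
    have v: "is_value v" by (simp add: v_def)
    have fst_v: "outcome (App (fst_tm TNat ?R) v) (Some (numeral_tm i))"
      and snd_v: "outcome (App (snd_tm TNat ?R) v) (Some (split_tuple r xs))"
      unfolding v_def using run_fst run_snd len by auto
    have "outcome (App (cons_tm n) (split_tuple r xs)) (Some (tuple_tm (r # xs)))"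
      using run_cons[of xs r] len by simp
    then have tl_v: "outcome (App (comp_tm ?I (cons_tm n) (snd_tm TNat ?R)) v) (Some (tuple_tm (r # xs)))"
      by (rule run_comp_Some[OF a_cons' arrow_snd v snd_v])
    have "outcome (App (cons_tm (n + 1)) (split_tuple i (r # xs))) (Some (tuple_tm (i # r # xs)))"
      using run_cons[of "r # xs" i] len by simp
    then have "outcome (App flat v) (Some (tuple_tm (i # r # xs)))"
      unfolding flat_def
      using run_comp_Some[OF a_cons arrow_fork[OF arrow_fst a_tl] v
          run_fork_Some[OF arrow_fst a_tl v fst_v tl_v]] len by simp
    then have g'_v: "outcome (App g' v) (map_option numeral_tm (G (i # r # xs)))"
      unfolding g'_def
      by (rule run_comp_Some[OF ag a_flat v _ realizes_run[OF g]]) (simp add: len)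
    have "outcome (App (comp_tm ?I (snd_tm TNat ?P) (snd_tm TNat ?R)) v) (Some (tuple_tm xs))"
      by (rule run_comp_Some[OF arrow_snd arrow_snd v snd_v]) (use run_snd len in auto)
    note acc_v = run_fork[OF a_g' arrow_comp[OF arrow_snd arrow_snd] v g'_v this]
    have "outcome (App (comp_tm ?I succ_fun_tm (fst_tm TNat ?R)) v) (Some (numeral_tm (Suc i)))"
      using run_comp_Some[OF arrow_succ_fun arrow_fst v fst_v run_succ_fun] by simp
    note idx_v = run_fork[OF arrow_comp[OF arrow_succ_fun arrow_fst] a_next_acc v this
        acc_v[folded next_acc_def]]
    have k: "is_value (pair_tm TNat ?I (numeral_tm k) v)" using v by simp
    have "outcome (App (comp_tm ?S next_idx (snd_tm TNat ?I)) (pair_tm TNat ?I (numeral_tm k) v))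
        (map_option (\<lambda>r'. pair_tm TNat ?R (numeral_tm (Suc i))
          (pair_tm TNat ?P (numeral_tm r') (tuple_tm xs))) (G (i # r # xs)))"
      by (rule run_comp_Some[OF a_next_idx arrow_snd k run_snd])
        (use idx_v[folded next_idx_def] v in \<open>cases "G (i # r # xs)"; simp\<close>)+
    note run_fork[OF arrow_fst arrow_comp[OF a_next_idx arrow_snd] k run_fst this,
        folded next_state_def]
    then have "outcome (App next_state (pair_tm TNat ?I (numeral_tm k) v))
        (map_option (\<lambda>r'. state k (Suc i) r' xs) (G (i # r # xs)))"
      using v by (cases "G (i # r # xs)") (auto simp: state_def)
    \<comment> \<open>The general composition rule is needed here because computing the next state
      may diverge.\<close>
    from run_comp[OF arrow_inl_fun a_next_state k this, of TNat "\<lambda>w. Some (inl_tm ?S TNat w)"]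
    have "outcome (App (comp_tm ?S (inl_fun_tm ?S TNat) next_state) (pair_tm TNat ?I (numeral_tm k) v))
        (map_option (\<lambda>r'. inl_tm ?S TNat (state k (Suc i) r' xs)) (G (i # r # xs)))"
      by (cases "G (i # r # xs)") (auto intro: run_inl_fun)
    from run_nat_case_succ[OF a_finish a_inl_next is_value_numeral v this]
    show ?thesis unfolding body_def state_def v_def numeral_tm.simps .
  qed

  have v_body: "is_value body" using a_body by (rule arrow_value)
  \<comment> \<open>Undefinedness persists at all later recursion arguments, so divergence at an
    intermediate stage agrees with the final value.\<close>
  have prec_None: "prec F G (i + k) xs = None" if "prec F G i xs = None" for i k xs
    using that by (induction k) auto
  \<comment> \<open>Loop invariant: with \<open>r\<close> the value at \<open>i\<close> and
    \<open>k\<close> rounds left, the result is the value at \<open>i + k\<close>. Both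
    \<open>i\<close> and \<open>r\<close> are generalized since every round changes them.\<close>
  have loop: "outcome (App (Itco ?S TNat body) (state k i r xs))
      (map_option numeral_tm (prec F G (i + k) xs))"
    if "length xs = n" "prec F G i xs = Some r" for k i r xs
    using that
  proof (induction k arbitrary: i r)
    case 0
    then show ?case using run_Itco_inr[OF v_body v_state run_body_0] by simp
  next
    case (Suc k)
    note run = run_body_Suc[OF Suc.prems(1), of k i r]
    show ?case
    proof (cases "G (i # r # xs)")
      case None
      then have "prec F G (i + Suc k) xs = None"
        using prec_None[of "Suc i" xs k] Suc.prems(2) by simp
      then show ?thesis using run_Itco_None[OF v_body v_state] run None by simp
    next
      case (Some r')
      then have "outcome (App (Itco ?S TNat body) (state k (Suc i) r' xs))
          (map_option numeral_tm (prec F G (Suc i + k) xs))"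
        using Suc by (intro Suc.IH) auto
      then show ?thesis using run_Itco_inl[OF v_body v_state] run Some by auto
    qed
  qed

  have "outcome (App t (tuple_tm (x # xs))) (map_option numeral_tm (prec F G x xs))"
    if len: "length xs = n" for x xs
  proof -
    define p where "p = split_tuple x xs"
    have p: "is_value p" by (simp add: p_def)
    have fst_p: "outcome (App (fst_tm TNat ?P) p) (Some (numeral_tm x))"
      and snd_p: "outcome (App (snd_tm TNat ?P) p) (Some (tuple_tm xs))"
      unfolding p_def using run_fst run_snd len by auto
    have a_f: "arrow (comp_tm ?R f (snd_tm TNat ?P)) ?R TNat"
      by (rule arrow_comp[OF af arrow_snd])
    have "outcome (App (comp_tm ?R f (snd_tm TNat ?P)) p) (map_option numeral_tm (F xs))"
      by (rule run_comp_Some[OF af arrow_snd p snd_p realizes_run[OF f len]])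
    note run_fork[OF a_f arrow_snd p this snd_p]
    note run_fork[OF arrow_const[OF T_zero] arrow_fork[OF a_f arrow_snd] p
        run_const[OF p T_zero] this]
    note run_fork[OF arrow_fst arrow_fork[OF arrow_const[OF T_zero] arrow_fork[OF a_f arrow_snd]] p
        fst_p this, folded start_def]
    then have start_p: "outcome (App start p) (map_option (\<lambda>r. state x 0 r xs) (F xs))"
      by (cases "F xs") (auto simp: state_def)
    have "outcome (App (uncons_tm n) (tuple_tm (x # xs))) (Some p)"
      unfolding p_def using run_uncons[of xs x] len by simp
    note init = run_comp_Some[OF a_start a_uncons is_value_tuple this start_p]
    show ?thesis
    proof (cases "F xs")
      case None
      \<comment> \<open>The value at \<open>0\<close> is \<open>F xs\<close>, so an undefined base
        case makes every value undefined.\<close>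
      moreover have "prec F G x xs = None" using prec_None[of 0 xs x] None by simp
      ultimately show ?thesis
        unfolding t_def
        using run_comp_None[OF arrow_Itco[OF a_body] a_init is_value_tuple] init by simp
    next
      case (Some r)
      then show ?thesis
        unfolding t_def
        using run_comp_Some[OF arrow_Itco[OF a_body] a_init is_value_tuple _ loop[OF len, of 0 r x]]
          init by simp
    qed
  qed
  then have "outcome (App t (tuple_tm xs)) (map_option numeral_tm (prec F G (hd xs) (tl xs)))"
    if "length xs = n + 1" for xs
    using that by (cases xs) auto
  then show ?thesis using a_t unfolding realizes_def by auto
qed

section \<open>Minimization\<close>

text \<open>If two first zeros differed, the value at the smaller one would be zero and, being below
  the larger one, also nonzero.\<close>

lemma is_first_zero_unique: "is_first_zero f xs y \<Longrightarrow> is_first_zero f xs z \<Longrightarrow> y = z"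
  unfolding is_first_zero_def by (metis linorder_neqE_nat option.inject)

text \<open>If \<open>F\<close> is defined and nonzero at every \<open>y\<close>, the loop runs
  forever. Otherwise the least \<open>y\<close> where this fails decides: an undefined value makes
  the body diverge there, and a zero makes the loop return \<open>y\<close>.\<close>

lemma realizable_pmin:
  assumes f: "realizes f (n + 1) F"
  shows "\<exists>t. realizes t n (pmin F)"
proof -
  let ?P = "nat_pow n"
  let ?S = "TNat \<otimes> ?P"
  define f' where "f' = comp_tm ?S f (cons_tm n)"
  define next_state where "next_state = fork_tm ?S TNat ?P
    (comp_tm ?S succ_fun_tm (fst_tm TNat ?P)) (snd_tm TNat ?P)"
  \<comment> \<open>The input is the predecessor of the nonzero value paired with the state;
    \<open>snd_tm\<close> discards the predecessor and keeps the state.\<close>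
  define continue where "continue = comp_tm (TNat \<otimes> ?S) (inl_fun_tm ?S TNat)
    (comp_tm (TNat \<otimes> ?S) next_state (snd_tm TNat ?S))"
  define finish where "finish = comp_tm ?S (inr_fun_tm ?S TNat) (fst_tm TNat ?P)"
  \<comment> \<open>Forking with the identity carries the state along while the value of
    \<open>F\<close> is tested.\<close>
  define body where "body = comp_tm ?S (nat_case_tm ?S finish continue)
    (fork_tm ?S TNat ?S f' (id_tm ?S))"
  define start where "start = fork_tm ?P TNat ?P (const_tm ?P zero_tm) (id_tm ?P)"
  define t where "t = comp_tm ?P (Itco ?S TNat body) start"

  have a_cons: "arrow (cons_tm n) ?S (nat_pow (n + 1))"
    using arrow_cons[of n] by simp
  note af = realizes_arrow[OF f]
  have a_f': "arrow f' ?S TNat"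
    unfolding f'_def by (rule arrow_comp[OF af a_cons])
  have a_next: "arrow next_state ?S ?S"
    unfolding next_state_def
    by (rule arrow_fork[OF arrow_comp[OF arrow_succ_fun arrow_fst] arrow_snd])
  have a_cont: "arrow continue (TNat \<otimes> ?S) (?S \<oplus> TNat)"
    unfolding continue_def by (rule arrow_comp[OF arrow_inl_fun arrow_comp[OF a_next arrow_snd]])
  have a_fin: "arrow finish ?S (?S \<oplus> TNat)"
    unfolding finish_def by (rule arrow_comp[OF arrow_inr_fun arrow_fst])
  note a_case = arrow_nat_case[OF a_fin a_cont] and a_fork = arrow_fork[OF a_f' arrow_id]
  have a_body: "arrow body ?S (?S \<oplus> TNat)"
    unfolding body_def by (rule arrow_comp[OF a_case a_fork])
  have a_start: "arrow start ?P ?S"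
    unfolding start_def by (intro arrow_fork arrow_const T_zero arrow_id)
  have a_t: "arrow t ?P TNat"
    unfolding t_def by (rule arrow_comp[OF arrow_Itco[OF a_body] a_start])
  have v_body: "is_value body" using a_body by (rule arrow_value)

  have "outcome (App t (tuple_tm xs)) (map_option numeral_tm (pmin F xs))"
    if len: "length xs = n" for xs
  proof -
    define state where "state y = pair_tm TNat ?P (numeral_tm y) (tuple_tm xs)" for y
    have v: "is_value (state y)" for y by (simp add: state_def)
    have fst_state: "outcome (App (fst_tm TNat ?P) (state y)) (Some (numeral_tm y))"
      and snd_state: "outcome (App (snd_tm TNat ?P) (state y)) (Some (tuple_tm xs))" for y
      unfolding state_def by (auto intro: run_fst run_snd)
    have "outcome (App f' (state y)) (map_option numeral_tm (F (y # xs)))" for y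
      unfolding f'_def
      by (rule run_comp_Some[OF af a_cons v _ realizes_run[OF f]])
        (use run_cons[of xs y] len in \<open>auto simp: state_def\<close>)
    note scrutinee = run_fork[OF a_f' arrow_id v this run_id[OF v]]
    have body_None: "outcome (App body (state y)) None" if "F (y # xs) = None" for y
      unfolding body_def using run_comp_None[OF a_case a_fork v] scrutinee[of y] that by simp
    have body_0: "outcome (App body (state y)) (Some (inr_tm ?S TNat (numeral_tm y)))"
      if "F (y # xs) = Some 0" for y
    proof -
      have "outcome (App finish (state y)) (Some (inr_tm ?S TNat (numeral_tm y)))"
        unfolding finish_def
        by (rule run_comp_Some[OF arrow_inr_fun arrow_fst v fst_state run_inr_fun]) simp
      note run_comp_Some[OF a_case a_fork v _ run_nat_case_zero[OF a_fin a_cont v this]]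
      then show ?thesis unfolding body_def using scrutinee[of y] that by simp
    qed
    have body_Suc: "outcome (App body (state y)) (Some (inl_tm ?S TNat (state (Suc y))))"
      if "F (y # xs) = Some (Suc k)" for y k
    proof -
      have "outcome (App (comp_tm ?S succ_fun_tm (fst_tm TNat ?P)) (state y))
          (Some (numeral_tm (Suc y)))"
        using run_comp_Some[OF arrow_succ_fun arrow_fst v fst_state run_succ_fun] by simp
      from run_fork_Some[OF arrow_comp[OF arrow_succ_fun arrow_fst] arrow_snd v this snd_state]
      have run_next: "outcome (App next_state (state y)) (Some (state (Suc y)))"
        unfolding next_state_def state_def .
      let ?w = "pair_tm TNat ?S (numeral_tm k) (state y)"
      have w: "is_value ?w" using v by simp
      have "outcome (App (comp_tm (TNat \<otimes> ?S) next_state (snd_tm TNat ?S)) ?w) (Some (state (Suc y)))"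
        by (rule run_comp_Some[OF a_next arrow_snd w run_snd run_next]) (auto simp: v)
      then have "outcome (App continue ?w) (Some (inl_tm ?S TNat (state (Suc y))))"
        unfolding continue_def
        by (rule run_comp_Some[OF arrow_inl_fun arrow_comp[OF a_next arrow_snd] w _ run_inl_fun[OF v]])
      note run_comp_Some[OF a_case a_fork v _
          run_nat_case_succ[OF a_fin a_cont is_value_numeral v this]]
      then show ?thesis unfolding body_def using scrutinee[of y] that by simp
    qed
    \<comment> \<open>Below \<open>y\<close> every round leads to the next state, so the outcome of
      the loop at \<open>y\<close> is transported back to the initial state.\<close>
    have shift: "outcome (App (Itco ?S TNat body) (state 0)) r"
      if "outcome (App (Itco ?S TNat body) (state y)) r" "\<forall>z<y. \<exists>v. F (z # xs) = Some v \<and> v \<noteq> 0"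
      for y r
      using that
    proof (induction y)
      case 0
      then show ?case by simp
    next
      case (Suc y)
      obtain k where "F (y # xs) = Some (Suc k)"
        using Suc.prems(2) by (metis lessI not0_implies_Suc)
      then have "outcome (App (Itco ?S TNat body) (state y)) r"
        using run_Itco_inl[OF v_body v body_Suc] Suc.prems(1) by blast
      then show ?case using Suc by simp
    qed
    have loop: "outcome (App (Itco ?S TNat body) (state 0)) (map_option numeral_tm (pmin F xs))"
    proof (cases "\<forall>y. \<exists>v. F (y # xs) = Some v \<and> v \<noteq> 0")
      case True
      then have "\<not> is_first_zero F xs y" for y
        unfolding is_first_zero_def by (metis option.inject)
      then have "pmin F xs = None" by (simp add: pmin_def)
      moreover have "outcome (App (Itco ?S TNat body) (state 0)) None"
      proof (rule run_Itco_forever[OF v_body])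
        show "state 0 \<in> range state" by blast
        show "is_value w \<and> (\<exists>u\<in>range state. outcome (App body w) (Some (inl_tm ?S TNat u)))"
          if "w \<in> range state" for w
        proof -
          obtain y where w: "w = state y" using \<open>w \<in> range state\<close> by blast
          obtain k where "F (y # xs) = Some (Suc k)"
            using True by (metis not0_implies_Suc)
          then show ?thesis using body_Suc v w by blast
        qed
      qed
      ultimately show ?thesis by simp
    next
      case False
      \<comment> \<open>The least argument at which \<open>F\<close> is either undefined or
        zero.\<close>
      define y where "y = (LEAST y. \<not> (\<exists>v. F (y # xs) = Some v \<and> v \<noteq> 0))"
      have y: "\<not> (\<exists>v. F (y # xs) = Some v \<and> v \<noteq> 0)"
        unfolding y_def by (rule LeastI_ex) (use False in blast)
      have below: "\<forall>z<y. \<exists>v. F (z # xs) = Some v \<and> v \<noteq> 0"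
        unfolding y_def using not_less_Least by blast
      show ?thesis
      proof (cases "F (y # xs)")
        case None
        \<comment> \<open>A first zero cannot lie below \<open>y\<close>, where values are nonzero,
          nor at \<open>y\<close>, nor above \<open>y\<close>, since it would require a defined
          value at \<open>y\<close>.\<close>
        have "\<not> is_first_zero F xs z" for z
          using None y below unfolding is_first_zero_def
          by (metis linorder_neqE_nat option.distinct(1) option.inject)
        then have "pmin F xs = None" by (simp add: pmin_def)
        then show ?thesis
          using shift[OF run_Itco_None[OF v_body v body_None[OF None]] below] by simp
      next
        case (Some z)
        then have z: "F (y # xs) = Some 0" using y by auto
        then have first: "is_first_zero F xs y" using below by (simp add: is_first_zero_def)
        then have "pmin F xs = Some y"
          unfolding pmin_def using is_first_zero_unique by (auto intro!: the_equality)
        then show ?thesis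
          using shift[OF run_Itco_inr[OF v_body v body_0[OF z]] below] by simp
      qed
    qed
    have "outcome (App start (tuple_tm xs)) (Some (state 0))"
      unfolding start_def state_def numeral_tm.simps
      by (intro run_fork_Some arrow_const T_zero arrow_id run_const[OF _ T_zero] run_id is_value_tuple) auto
    then show ?thesis
      unfolding t_def
      by (rule run_comp_Some[OF arrow_Itco[OF a_body] a_start is_value_tuple _ loop])
  qed
  then show ?thesis using a_t unfolding realizes_def by blast
qed

section \<open>Assembly by induction on partial recursive functions\<close>

lemma partial_recursive_realizable: "partial_recursive n f \<Longrightarrow> \<exists>t. realizes t n f"
proof (induction rule: partial_recursive.induct)
  case (PR_zero n)
  then show ?case using realizes_zero by blast
next
  case PR_succ
  then show ?case using realizes_succ by blast
next
  case (PR_proj i n)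
  then show ?case by (rule realizable_proj)
next
  case (PR_comp gs f n)
  then show ?case using realizable_pcomp by blast
next
  case (PR_prec n f g)
  then show ?case using realizable_prec by blast
next
  case (PR_min n f)
  then show ?case using realizable_pmin by blast
next
  case (PR_ext n f g)
  \<comment> \<open>Realization concerns only lists of length \<open>n\<close>, on which the two
    functions agree.\<close>
  then show ?case by (auto simp: realizes_def)
qed

theorem theorem1p1:
  fixes n :: nat and f :: "nat list \<Rightarrow> nat option"
  assumes "partial_recursive n f"
  shows "\<exists>t. [] \<turnstile> t : nat_pow n \<rightarrow> TNat \<and>
    (\<forall>xs. length xs = n \<longrightarrow>
      (\<forall>y. evaluates_to (App t (tuple_tm xs)) (numeral_tm y) \<longleftrightarrow> f xs = Some y) \<and>
      (f xs = None \<longrightarrow> \<not> terminates (App t (tuple_tm xs))))"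
proof -
  obtain t where t: "realizes t n f"
    using partial_recursive_realizable[OF assms] by blast
  have "(\<forall>y. evaluates_to (App t (tuple_tm xs)) (numeral_tm y) \<longleftrightarrow> f xs = Some y) \<and>
      (f xs = None \<longrightarrow> \<not> terminates (App t (tuple_tm xs)))" if "length xs = n" for xs
  proof (cases "f xs")
    case None
    then have "\<not> terminates (App t (tuple_tm xs))"
      using realizes_run[OF t that] by (simp add: outcome_def)
    \<comment> \<open>Divergence rules out evaluation to any numeral, so both sides of the
      equivalence are false.\<close>
    then show ?thesis using None by (auto simp: terminates_def)
  next
    case (Some z)
    then have z: "App t (tuple_tm xs) \<leadsto>* numeral_tm z"
      using realizes_run[OF t that] by (simp add: outcome_def)
    then have "evaluates_to (App t (tuple_tm xs)) (numeral_tm z)"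
      using value_no_step[OF is_value_numeral] by (simp add: evaluates_to_def)
    \<comment> \<open>For the converse, the result of evaluation is unique and numerals are
      injective, so evaluation to the numeral of \<open>y\<close> forces
      \<open>y = z\<close>.\<close>
    then show ?thesis
      using evaluates_to_value_unique[OF z is_value_numeral] Some
      by (metis numeral_tm_inject option.distinct(1) option.inject)
  qed
  then show ?thesis using arrow_type[OF realizes_arrow[OF t]] by blast
qed

end
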